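(* Let $(X,d)$ be a metric space and let $G$ be an abelian semigroup of continuous self maps of $X$ (a set of non-identity continuous maps $X\to X$ closed under composition, with $f\circ g=g\circ f$ for all $f,g\in G$), generated by a family $\{g_\alpha\}_\alpha$. Then the chain recurrent set $\mathsf{CR}(G)$ of $G$ is the complement of the union of the sets $B(A)\setminus A$ as $A$ varies over the collection of attractors of $G$: $$X\setminus \mathsf{CR}(G)=\bigcup_A\,[B(A)\setminus A],$$ where $B(A)$ denotes the basin of attraction of $A$.
   Context: Semigroups. A continuous semigroup $G$ on $X$ is a set of non-identity continuous maps $X\to X$ closed under composition. $G=\langle g_\alpha\rangle_\alpha$ is generated by the family $\{g_\alpha\}_\alpha$ of continuous self maps of $X$ if every element of $G$ is a (finite) composition of iterates of members of the family. Put $\widehat G=G\cup\{\mathrm{identity}\}$. Products such as $fh$ denote composition $f\circ h$. Chain recurrence. $P(X)$ is the set of continuous functions $\epsilon:X\to(0,\infty)$. For $a,b\in X$, $g\in G$, $\epsilon\in P(X)$, an $(\epsilon,g)$-chain from $a$ to $b$ is a finite sequence $(a=x_1,\dots,x_{n+1}=b;\,g_1,\dots,g_n)$, $n\ge 1$, with $x_i\in X$ and $g_i\in\widehat G$, such that $d(g_i\circ g(x_i),x_{i+1})<\epsilon(g_i\circ g(x_i))$ for each $i=1,\dots,n$. A point $x\in X$ is chain recurrent for $G$ if for every $\epsilon\in P(X)$ and every $g\in G$ there is an $(\epsilon,g)$-chain from $x$ to itself. $\mathsf{CR}(G)$ is the set of all chain recurrent points. Unbounded sequences. A sequence $(f_k)_{k\in\mathbb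 N}$ in $G$ is unbounded if there are a sequence $(n_k)_k$ of natural numbers with $n_k\to\infty$ and a single generator $g_{\alpha_0}$ such that each $f_k$ consists of exactly $n_k$ iterates of $g_{\alpha_0}$, i.e. $f_k$ can be written as $$f_k=h_{n_k+1}\circ g_{\alpha_0}\circ h_{n_k}\circ g_{\alpha_0}\circ\cdots\circ h_2\circ g_{\alpha_0}\circ h_1,$$ where each $h_i\in\widehat G$ (depending on $k$) is independent of $g_{\alpha_0}$, i.e. is the identity or a composition of generators other than $g_{\alpha_0}$. Trapping regions, attractors, basins. A nonempty open set $U\subset X$ is a trapping region for $G$ if there is an $h\in G$ such that, for $\widetilde U:=\{f h(x): x\in U,\ f\in\widehat G\}$, the closure satisfies $\mathrm{cl}(\widetilde U)\subset U$. The attractor determined by the trapping region $U$ (with such an $h$) is the set $A$ of all $x\in X$ such that for every open $V\subset X$ containing $x$ there is some unbounded sequence $(f_k)_k$ in $G$ with $V\cap f_k(h(U))\neq\emptyset$ for infinitely many $k\in\mathbb N$. The basin of attraction of the attractor $A$ determined by $U$ is $$B(A):=\{x\in X: f(x)\in U\text{ for some }f\in G\}.$$ In the union over $A$, every trapping region $U$ together with every $h\in G$ witnessing that $U$ is a trapping region gives an attractor $A$, and $B(A)$ is formed using that same $U$. *)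

theory Defs
  imports "HOL-Analysis.Analysis"
begin

definition continuous_semigroup :: "('a::metric_space \<Rightarrow> 'a) set \<Rightarrow> bool" where
  "continuous_semigroup G \<longleftrightarrow>
     (\<forall>f\<in>G. continuous_on UNIV f \<and> f \<noteq> id) \<and> (\<forall>f\<in>G. \<forall>h\<in>G. f \<circ> h \<in> G)"

definition abelian :: "('a \<Rightarrow> 'a) set \<Rightarrow> bool" where
  "abelian G \<longleftrightarrow> (\<forall>f\<in>G. \<forall>h\<in>G. f \<circ> h = h \<circ> f)"

definition hat :: "('a \<Rightarrow> 'a) set \<Rightarrow> ('a \<Rightarrow> 'a) set" where
  "hat G = insert id G"

text \<open>Finite compositions of one or more members of \<open>S\<close>; the empty composition is excluded.\<close>

inductive_set compositions :: "('a \<Rightarrow> 'a) set \<Rightarrow> ('a \<Rightarrow> 'a) set" for S where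
  member: "f \<in> S \<Longrightarrow> f \<in> compositions S"
| comp: "f \<in> compositions S \<Longrightarrow> h \<in> compositions S \<Longrightarrow> f \<circ> h \<in> compositions S"

text \<open>The generators belong to the semigroup they generate. Iterates are taken with positive
  exponent.\<close>

definition generated_by :: "('a \<Rightarrow> 'a) set \<Rightarrow> 'i set \<Rightarrow> ('i \<Rightarrow> 'a \<Rightarrow> 'a) \<Rightarrow> bool" where
  "generated_by G I g \<longleftrightarrow>
     g ` I \<subseteq> G \<and> G \<subseteq> compositions {g \<alpha> ^^ m | \<alpha> m. \<alpha> \<in> I \<and> m \<ge> 1}"

definition pos_continuous :: "('a::metric_space \<Rightarrow> real) set" where
  "pos_continuous = {\<epsilon>. continuous_on UNIV \<epsilon> \<and> (\<forall>x. \<epsilon> x > 0)}"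

definition has_chain ::
  "('a::metric_space \<Rightarrow> 'a) set \<Rightarrow> ('a \<Rightarrow> real) \<Rightarrow> ('a \<Rightarrow> 'a) \<Rightarrow> 'a \<Rightarrow> 'a \<Rightarrow> bool" where
  "has_chain G \<epsilon> g a b \<longleftrightarrow>
     (\<exists>(n::nat) (x :: nat \<Rightarrow> 'a) (gs :: nat \<Rightarrow> 'a \<Rightarrow> 'a).
        n \<ge> 1 \<and> x 1 = a \<and> x (n + 1) = b \<and>
        (\<forall>i\<in>{1..n}. gs i \<in> hat G \<and>
           dist ((gs i \<circ> g) (x i)) (x (i + 1)) < \<epsilon> ((gs i \<circ> g) (x i))))"

definition CR :: "('a::metric_space \<Rightarrow> 'a) set \<Rightarrow> 'a set" where
  "CR G = {x. \<forall>\<epsilon>\<in>pos_continuous. \<forall>g\<in>G. has_chain G \<epsilon> g x x}"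

text \<open>A generator is ``other than'' \<open>g \<alpha>0\<close> if it is a different map, so a repetition of the
  map \<open>g \<alpha>0\<close> in the family under another index does not count as a different generator.\<close>

definition independent_of ::
  "('a \<Rightarrow> 'a) set \<Rightarrow> 'i set \<Rightarrow> ('i \<Rightarrow> 'a \<Rightarrow> 'a) \<Rightarrow> 'i \<Rightarrow> ('a \<Rightarrow> 'a) set" where
  "independent_of G I g \<alpha>0 = {h \<in> hat G. h = id \<or> h \<in> compositions (g ` I - {g \<alpha>0})}"

text \<open>\<open>interleave u h n = h (n+1) \<circ> u \<circ> h n \<circ> u \<circ> \<dots> \<circ> h 2 \<circ> u \<circ> h 1\<close>,
  with exactly \<open>n\<close> occurrences of \<open>u\<close>.\<close>

primrec interleave :: "('a \<Rightarrow> 'a) \<Rightarrow> (nat \<Rightarrow> 'a \<Rightarrow> 'a) \<Rightarrow> nat \<Rightarrow> 'a \<Rightarrow> 'a" where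
  "interleave u h 0 = h 1"
| "interleave u h (Suc n) = h (n + 2) \<circ> u \<circ> interleave u h n"

definition unbounded_seq ::
  "('a \<Rightarrow> 'a) set \<Rightarrow> 'i set \<Rightarrow> ('i \<Rightarrow> 'a \<Rightarrow> 'a) \<Rightarrow> (nat \<Rightarrow> 'a \<Rightarrow> 'a) \<Rightarrow> bool" where
  "unbounded_seq G I g f \<longleftrightarrow> (\<forall>k. f k \<in> G) \<and>
     (\<exists>(n :: nat \<Rightarrow> nat) \<alpha>0. filterlim n at_top sequentially \<and> \<alpha>0 \<in> I \<and>
        (\<forall>k. \<exists>h. (\<forall>i\<in>{1..n k + 1}. h i \<in> independent_of G I g \<alpha>0) \<and>
                 f k = interleave (g \<alpha>0) h (n k)))"

definition trapping_region_with ::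
  "('a::metric_space \<Rightarrow> 'a) set \<Rightarrow> 'a set \<Rightarrow> ('a \<Rightarrow> 'a) \<Rightarrow> bool" where
  "trapping_region_with G U h \<longleftrightarrow>
     open U \<and> U \<noteq> {} \<and> h \<in> G \<and> closure {(f \<circ> h) x | f x. x \<in> U \<and> f \<in> hat G} \<subseteq> U"

definition attractor ::
  "('a::metric_space \<Rightarrow> 'a) set \<Rightarrow> 'i set \<Rightarrow> ('i \<Rightarrow> 'a \<Rightarrow> 'a) \<Rightarrow> 'a set \<Rightarrow> ('a \<Rightarrow> 'a) \<Rightarrow> 'a set" where
  "attractor G I g U h =
     {x. \<forall>V. open V \<and> x \<in> V \<longrightarrow>
           (\<exists>f. unbounded_seq G I g f \<and> (\<exists>\<^sub>\<infinity>k. V \<inter> f k ` (h ` U) \<noteq> {}))}"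

text \<open>The basin depends on the trapping region \<open>U\<close>, not only on the attractor as a set.\<close>

definition basin :: "('a \<Rightarrow> 'a) set \<Rightarrow> 'a set \<Rightarrow> 'a set" where
  "basin G U = {x. \<exists>f\<in>G. f x \<in> U}"

end

(* If x is not chain recurrent, witnessed by eps and g, then the set of points reachable from x
   by (eps,g)-chains is a trapping region for g: eps is bounded below near a limit point z of
   points f(g(y)), so z is reachable as well. This region contains g(x) but not x, and it
   contains its attractor, so x lies in the basin but not in the attractor. Conversely, let f(x)
   lie in a trapping region U for h, and choose eps so small that eps-errors made on the closure
   of the forward image of h(U) do not leave U. Points of (eps, u^k h h f h)-chains starting at x
   are then mapped into U by f h, and by commutativity the last step of a closed chain at x
   exhibits a point of F(h(U)) near x with F containing at least k factors u; letting k grow puts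
   x into the attractor. *)

theory Submission
  imports Defs
begin

section \<open>Closure and commutation in the semigroup\<close>

lemma hat_comp:
  assumes "continuous_semigroup G" "f \<in> hat G" "h \<in> hat G"
  shows "f \<circ> h \<in> hat G"
  using assms by (auto simp: continuous_semigroup_def hat_def)

lemma hat_commute:
  assumes "abelian G" "f \<in> hat G" "h \<in> hat G"
  shows "f \<circ> h = h \<circ> f"
  using assms by (auto simp: abelian_def hat_def)

lemma comp_hat:
  assumes "continuous_semigroup G" "f \<in> G" "h \<in> hat G"
  shows "f \<circ> h \<in> G" "h \<circ> f \<in> G"
  using assms by (auto simp: continuous_semigroup_def hat_def)

lemma hat_funpow:
  assumes "continuous_semigroup G" "f \<in> hat G"
  shows "f ^^ m \<in> hat G"
proof (induction m)
  case 0
  then show ?case by (simp add: hat_def id_def)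
next
  case (Suc m)
  show ?case unfolding funpow.simps by (rule hat_comp[OF assms Suc])
qed

section \<open>Splitting off one generator and building unbounded sequences\<close>

lemma compositions_funpow:
  assumes "f \<in> compositions S"
  shows "f ^^ Suc m \<in> compositions S"
proof (induction m)
  case 0
  show ?case using assms by simp
next
  case (Suc m)
  show ?case unfolding funpow.simps(2)[of "Suc m"] by (rule compositions.comp[OF assms Suc])
qed

lemma independent_of_comp:
  assumes "continuous_semigroup G" "f \<in> independent_of G I g \<alpha>" "h \<in> independent_of G I g \<alpha>"
  shows "f \<circ> h \<in> independent_of G I g \<alpha>"
  using assms hat_comp[OF assms(1)] by (auto simp: independent_of_def intro: compositions.comp)

text \<open>Commutativity lets all occurrences of \<open>g \<alpha>\<close> be collected on the
  right; what remains involves only the other generators.\<close>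

lemma generator_factorization:
  assumes G: "continuous_semigroup G" and ab: "abelian G" and gen: "generated_by G I g"
    and \<alpha>: "\<alpha> \<in> I" and f: "f \<in> G"
  obtains r m where "r \<in> independent_of G I g \<alpha>" "f = r \<circ> g \<alpha> ^^ m"
proof -
  have gG: "g \<beta> \<in> hat G" if "\<beta> \<in> I" for \<beta>
    using gen that by (auto simp: generated_by_def hat_def)
  have id: "id \<in> independent_of G I g \<alpha>"
    by (simp add: independent_of_def hat_def)
  have "f \<in> compositions {g \<beta> ^^ m | \<beta> m. \<beta> \<in> I \<and> m \<ge> 1}"
    using gen f by (auto simp: generated_by_def)
  then have "\<exists>r m. r \<in> independent_of G I g \<alpha> \<and> f = r \<circ> g \<alpha> ^^ m"
  proof induction
    case (member f)
    then obtain \<beta> m where \<beta>: "\<beta> \<in> I" "m \<ge> 1" "f = g \<beta> ^^ m" by auto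
    \<comment> \<open>Independence compares maps, not indices, so an index other than
      \<open>\<alpha>\<close> with the same map must also be counted into the power.\<close>
    show ?case
    proof (cases "g \<beta> = g \<alpha>")
      case True
      then show ?thesis using \<beta>(3) id by (metis id_comp)
    next
      case False
      then have "g \<beta> \<in> compositions (g ` I - {g \<alpha>})"
        using \<beta>(1) by (auto intro: compositions.member)
      then have "f \<in> compositions (g ` I - {g \<alpha>})"
        using compositions_funpow[of "g \<beta>" _ "m - 1"] \<beta> by simp
      then have "f \<in> independent_of G I g \<alpha>"
        using hat_funpow[OF G gG[OF \<beta>(1)]] \<beta>(3) by (simp add: independent_of_def)
      moreover have "f = f \<circ> g \<alpha> ^^ 0" by (simp add: id_def comp_def)
      ultimately show ?thesis by blast
    qed
  next
    case (comp f h)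
    then obtain r m s n where r: "r \<in> independent_of G I g \<alpha>" "f = r \<circ> g \<alpha> ^^ m"
      and s: "s \<in> independent_of G I g \<alpha>" "h = s \<circ> g \<alpha> ^^ n" by blast
    have "g \<alpha> ^^ m \<circ> s = s \<circ> g \<alpha> ^^ m"
      using hat_commute[OF ab hat_funpow[OF G gG[OF \<alpha>]]] s(1) by (simp add: independent_of_def)
    then have "f \<circ> h = (r \<circ> s) \<circ> g \<alpha> ^^ (m + n)"
      unfolding r(2) s(2) funpow_add by (metis comp_assoc)
    then show ?case using independent_of_comp[OF G r(1) s(1)] by blast
  qed
  then show ?thesis using that by blast
qed

text \<open>This brings a product with a power of \<open>u\<close> into the shape demanded of
  unbounded sequences: all separators are trivial except the outermost one.\<close>

lemma interleave_leading_factor: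
  "interleave u (\<lambda>i. if i = Suc n then r else id) n = r \<circ> u ^^ n"
proof -
  \<comment> \<open>With m < n only indices up to n occur, so the exceptional index
    \<open>Suc n\<close> is not yet reached.\<close>
  have *: "interleave u (\<lambda>i. if i = Suc n then r else id) m = u ^^ m" if "m < n" for m
    using that
  proof (induction m)
    case 0
    then show ?case by (simp add: id_def)
  next
    case (Suc m)
    then show ?case unfolding interleave.simps funpow.simps by simp
  qed
  show ?thesis
  proof (cases n)
    case 0
    then show ?thesis by (simp add: fun_eq_iff)
  next
    case (Suc m)
    then show ?thesis using *[of m] by (simp add: fun_eq_iff)
  qed
qed

text \<open>Each \<open>f k\<close> may itself contain \<open>g \<alpha>\<close>. Its exponent
  \<open>m k\<close> only adds to k, so the exact count m k + k still tends to infinity.\<close>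

lemma unbounded_seq_if_factor:
  assumes G: "continuous_semigroup G" and ab: "abelian G" and gen: "generated_by G I g"
    and \<alpha>: "\<alpha> \<in> I" and f: "\<And>k. f k \<in> G"
  shows "unbounded_seq G I g (\<lambda>k. f k \<circ> g \<alpha> ^^ k)"
proof -
  have "\<exists>r m. r \<in> independent_of G I g \<alpha> \<and> f k = r \<circ> g \<alpha> ^^ m" for k
    using generator_factorization[OF G ab gen \<alpha> f] by metis
  then obtain r m where r: "\<And>k. r k \<in> independent_of G I g \<alpha>" "\<And>k. f k = r k \<circ> g \<alpha> ^^ m k"
    by metis
  have "g \<alpha> \<in> hat G" using gen \<alpha> by (auto simp: generated_by_def hat_def)
  then have G_mem: "f k \<circ> g \<alpha> ^^ k \<in> G" for k
    using comp_hat(1)[OF G f hat_funpow[OF G]] by blast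
  have lim: "filterlim (\<lambda>k. m k + k) at_top sequentially"
    by (rule filterlim_at_top_mono[OF filterlim_ident]) auto
  have "f k \<circ> g \<alpha> ^^ k =
      interleave (g \<alpha>) (\<lambda>i. if i = Suc (m k + k) then r k else id) (m k + k)" for k
    unfolding interleave_leading_factor r(2) funpow_add by (rule comp_assoc)
  moreover have "id \<in> independent_of G I g \<alpha>"
    by (simp add: independent_of_def hat_def)
  ultimately have "\<exists>h. (\<forall>i\<in>{1..m k + k + 1}. h i \<in> independent_of G I g \<alpha>) \<and>
      f k \<circ> g \<alpha> ^^ k = interleave (g \<alpha>) h (m k + k)" for k
    using r(1) by (intro exI[of _ "\<lambda>i. if i = Suc (m k + k) then r k else id"]) simp
  then show ?thesis
    unfolding unbounded_seq_def using G_mem lim \<alpha> by blast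
qed

section \<open>Error functions and chains\<close>

lemma pos_continuous_radius:
  fixes C U :: "'a::metric_space set"
  assumes "closed C" "open U" "C \<subseteq> U" "\<delta> > 0"
  obtains \<epsilon> where "\<epsilon> \<in> pos_continuous" "\<And>y. \<epsilon> y \<le> \<delta>" "\<And>y. y \<in> C \<Longrightarrow> ball y (\<epsilon> y) \<subseteq> U"
\<comment> \<open>The degenerate cases are split off because \<open>infdist\<close> to the empty set
  is 0 and the sum below could then vanish.\<close>
proof (cases "U = UNIV \<or> C = {}")
  case True
  then show ?thesis using that[of "\<lambda>_. \<delta>"] assms by (auto simp: pos_continuous_def)
next
  case False
  \<comment> \<open>The two distances cannot both be 0, since C and the complement of U are disjoint
    closed sets. On C the second summand vanishes, leaving at most the distance to the complement of
    U.\<close>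
  let ?\<epsilon> = "\<lambda>y. min \<delta> (infdist y (-U) + infdist y C)"
  have pos: "infdist y (-U) + infdist y C > 0" for y
  proof (cases "y \<in> C")
    case True
    then have "infdist y (-U) > 0"
      using in_closed_iff_infdist_zero[of "-U" y] infdist_nonneg[of y "-U"] assms False
      by (auto simp: closed_Compl less_le)
    then show ?thesis using infdist_nonneg[of y C] by linarith
  next
    case F: False
    then have "infdist y C > 0"
      using in_closed_iff_infdist_zero[of C y] infdist_nonneg[of y C] assms False
      by (auto simp: less_le)
    then show ?thesis using infdist_nonneg[of y "-U"] by linarith
  qed
  show ?thesis
  proof (rule that[of ?\<epsilon>])
    show "?\<epsilon> \<in> pos_continuous"
      using pos assms by (auto simp: pos_continuous_def intro!: continuous_intros)
    show "ball y (?\<epsilon> y) \<subseteq> U" if "y \<in> C" for y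
    proof
      fix z assume "z \<in> ball y (?\<epsilon> y)"
      then have "dist y z < infdist y (-U)" using that by simp
      then show "z \<in> U" using infdist_le[of z "-U" y] by force
    qed
  qed auto
qed

text \<open>An invariant P is carried along the chain as far as the start of its last step; only
  that step is kept.\<close>

lemma has_chain_last:
  assumes "has_chain G \<epsilon> g a b" and "P a"
    and step: "\<And>y z f. P y \<Longrightarrow> f \<in> hat G \<Longrightarrow> dist (f (g y)) z < \<epsilon> (f (g y)) \<Longrightarrow> P z"
  obtains y f where "P y" "f \<in> hat G" "dist (f (g y)) b < \<epsilon> (f (g y))"
proof -
  from assms(1) obtain n x gs where n: "(n::nat) \<ge> 1" "x 1 = a" "x (n + 1) = b"
    and gs: "\<And>i. i \<in> {1..n} \<Longrightarrow> gs i \<in> hat G \<and> dist (gs i (g (x i))) (x (i + 1)) < \<epsilon> (gs i (g (x i)))"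
    unfolding has_chain_def comp_apply by blast
  have "P (x (Suc i))" if "i < n" for i
    using that
  proof (induction i)
    case 0
    then show ?case using n assms(2) by simp
  next
    case (Suc i)
    then show ?case using gs[of "Suc i"] step[of "x (Suc i)" "gs (Suc i)" "x (Suc (Suc i))"] by auto
  qed
  then have "P (x n)" using n(1) by (cases n) auto
  then show ?thesis using that gs[of n] n by auto
qed

lemma has_chain_single:
  assumes "f \<in> hat G" "dist (f (g a)) b < \<epsilon> (f (g a))"
  shows "has_chain G \<epsilon> g a b"
  unfolding has_chain_def
  by (rule exI[of _ 1], rule exI[of _ "\<lambda>i. if i = 1 then a else b"], rule exI[of _ "\<lambda>_. f"])
    (use assms in auto)

lemma has_chain_snoc:
  assumes "has_chain G \<epsilon> g a b" "f \<in> hat G" "dist (f (g b)) c < \<epsilon> (f (g b))"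
  shows "has_chain G \<epsilon> g a c"
proof -
  from assms(1) obtain n x gs where n: "(n::nat) \<ge> 1" "x 1 = a" "x (n + 1) = b"
    and gs: "\<forall>i\<in>{1..n}. gs i \<in> hat G \<and> dist ((gs i \<circ> g) (x i)) (x (i + 1)) < \<epsilon> ((gs i \<circ> g) (x i))"
    unfolding has_chain_def by auto
  show ?thesis
    unfolding has_chain_def
    by (rule exI[of _ "Suc n"], rule exI[of _ "x(Suc (Suc n) := c)"], rule exI[of _ "gs(Suc n := f)"])
      (use n gs assms in \<open>auto simp: le_Suc_eq\<close>)
qed

lemma open_has_chain: "open {y. has_chain G \<epsilon> g x y}"
proof (rule openI, clarify)
  fix b assume b: "has_chain G \<epsilon> g x b"
  \<comment> \<open>Chains have at least one step, so x need not be reachable from itself and is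
    listed separately as a possible start of the last step.\<close>
  obtain y f where yf: "y = x \<or> has_chain G \<epsilon> g x y" "f \<in> hat G" "dist (f (g y)) b < \<epsilon> (f (g y))"
    by (rule has_chain_last[OF b, of "\<lambda>y. y = x \<or> has_chain G \<epsilon> g x y"])
      (auto intro: has_chain_single has_chain_snoc)
  have "ball (f (g y)) (\<epsilon> (f (g y))) \<subseteq> {y. has_chain G \<epsilon> g x y}"
    using yf by (auto intro: has_chain_single has_chain_snoc)
  then show "\<exists>T>0. ball b T \<subseteq> {y. has_chain G \<epsilon> g x y}"
    using open_ball openE[of "ball (f (g y)) (\<epsilon> (f (g y)))" b] yf(3)
    by (metis mem_ball subset_trans)
qed

text \<open>Chain errors are measured by \<open>\<epsilon>\<close> at w, not at the limit z.
  Continuity makes \<open>\<epsilon> w\<close> approach the positive number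
  \<open>\<epsilon> z\<close> while the distance tends to 0.\<close>

lemma closure_near:
  fixes S :: "'a::metric_space set"
  assumes "\<epsilon> \<in> pos_continuous" "z \<in> closure S"
  obtains w where "w \<in> S" "dist w z < \<epsilon> w"
proof -
  from assms(2) obtain w where w: "\<And>n. w n \<in> S" "w \<longlonglongrightarrow> z"
    unfolding closure_sequential by blast
  have "(\<lambda>n. \<epsilon> (w n)) \<longlonglongrightarrow> \<epsilon> z"
    by (rule continuous_on_tendsto_compose[of UNIV \<epsilon>, OF _ w(2)])
      (use assms(1) in \<open>simp_all add: pos_continuous_def\<close>)
  moreover have "(\<lambda>n. dist (w n) z) \<longlonglongrightarrow> 0" using w(2) by (rule iffD1[OF tendsto_dist_iff])
  ultimately have "(\<lambda>n. \<epsilon> (w n) - dist (w n) z) \<longlonglongrightarrow> \<epsilon> z - 0" by (rule tendsto_diff)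
  then have "\<forall>\<^sub>F n in sequentially. \<epsilon> (w n) - dist (w n) z > 0"
    by (rule order_tendstoD) (use assms(1) in \<open>simp add: pos_continuous_def\<close>)
  then obtain n where "\<epsilon> (w n) - dist (w n) z > 0"
    by (meson eventually_happens trivial_limit_sequentially)
  then show ?thesis using that[of "w n"] w(1) by auto
qed

section \<open>Trapping regions, attractors and chain recurrence\<close>

lemma trapping_region_has_chain:
  assumes "\<epsilon> \<in> pos_continuous" "g \<in> G"
  shows "trapping_region_with G {y. has_chain G \<epsilon> g x y} g"
  unfolding trapping_region_with_def
proof (intro conjI)
  have "has_chain G \<epsilon> g x (g x)"
    by (rule has_chain_single[of id]) (use assms in \<open>auto simp: hat_def pos_continuous_def\<close>)
  then show "{y. has_chain G \<epsilon> g x y} \<noteq> {}" by blast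
  show "closure {(f \<circ> g) y |f y. y \<in> {y. has_chain G \<epsilon> g x y} \<and> f \<in> hat G} \<subseteq> {y. has_chain G \<epsilon> g x y}"
  proof
    fix z assume "z \<in> closure {(f \<circ> g) y |f y. y \<in> {y. has_chain G \<epsilon> g x y} \<and> f \<in> hat G}"
    from closure_near[OF assms(1) this] obtain w
      where "w \<in> {(f \<circ> g) y |f y. y \<in> {y. has_chain G \<epsilon> g x y} \<and> f \<in> hat G}" "dist w z < \<epsilon> w" .
    then obtain f y where
      "has_chain G \<epsilon> g x y" "f \<in> hat G" "dist (f (g y)) z < \<epsilon> (f (g y))" by auto
    then show "z \<in> {y. has_chain G \<epsilon> g x y}" by (auto intro: has_chain_snoc)
  qed
qed (use open_has_chain assms(2) in blast)+

lemma attractor_subset: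
  assumes "trapping_region_with G U h"
  shows "attractor G I g U h \<subseteq> U"
proof
  fix x assume x: "x \<in> attractor G I g U h"
  have "x \<in> closure {(f \<circ> h) x | f x. x \<in> U \<and> f \<in> hat G}"
    unfolding closure_iff_nhds_not_empty
  proof (intro allI impI)
    fix A V assume "V \<subseteq> A" "open V" "x \<in> V"
    then obtain f where f: "unbounded_seq G I g f" "\<exists>\<^sub>\<infinity>k. V \<inter> f k ` (h ` U) \<noteq> {}"
      using x unfolding attractor_def by blast
    obtain k where "V \<inter> f k ` (h ` U) \<noteq> {}" using INFM_EX[OF f(2)] by blast
    moreover have "f k \<in> hat G" using f(1) by (auto simp: unbounded_seq_def hat_def)
    ultimately show "{(f \<circ> h) x |f x. x \<in> U \<and> f \<in> hat G} \<inter> A \<noteq> {}"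
      using \<open>V \<subseteq> A\<close> by fastforce
  qed
  then show "x \<in> U" using assms by (auto simp: trapping_region_with_def)
qed

lemma CR_basin_subset_attractor:
  assumes G: "continuous_semigroup G" and ab: "abelian G" and gen: "generated_by G I g"
    and trap: "trapping_region_with G U h" and x: "x \<in> CR G" "x \<in> basin G U"
  shows "x \<in> attractor G I g U h"
  unfolding attractor_def
proof (intro CollectI allI impI)
  fix V assume "open V \<and> x \<in> V"
  then obtain \<delta> where \<delta>: "\<delta> > 0" "ball x \<delta> \<subseteq> V" using openE by blast
  define C where "C = closure {(f \<circ> h) x | f x. x \<in> U \<and> f \<in> hat G}"
  have U: "open U" "h \<in> G" "C \<subseteq> U" using trap by (auto simp: trapping_region_with_def C_def)
  have C: "f (h y) \<in> C" if "f \<in> hat G" "y \<in> U" for f y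
    unfolding C_def by (rule subsetD[OF closure_subset]) (use that in auto)
  obtain \<epsilon> where \<epsilon>: "\<epsilon> \<in> pos_continuous" "\<And>y. \<epsilon> y \<le> \<delta>" "\<And>y. y \<in> C \<Longrightarrow> ball y (\<epsilon> y) \<subseteq> U"
    using pos_continuous_radius[OF _ U(1) U(3) \<delta>(1)] by (auto simp: C_def)
  obtain f where f: "f \<in> G" "f x \<in> U" using x(2) by (auto simp: basin_def)
  have hats: "h \<in> hat G" "f \<in> hat G" "id \<in> hat G" using U(2) f(1) by (auto simp: hat_def)
  \<comment> \<open>x itself need not lie in U, but \<open>p x\<close> does, because f and h
    commute. As p also maps U into itself, \<open>p y \<in> U\<close> can serve as the invariant
    along chains.\<close>
  define p where "p = f \<circ> h"
  have p: "p \<in> G" "p \<in> hat G" using comp_hat(1)[OF G f(1) hats(1)] by (auto simp: p_def hat_def)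
  have pU: "p y \<in> U" if "y \<in> U" for y
    using C[OF hats(2) that] U(3) by (auto simp: p_def)
  have px: "p x \<in> U"
    using C[OF hats(3) f(2)] U(3) hat_commute[OF ab hats(1) hats(2)]
    by (auto simp: p_def fun_eq_iff)
  \<comment> \<open>Since h lies in G, there must be at least one generator to iterate.\<close>
  have "compositions ({} :: ('a \<Rightarrow> 'a) set) = {}"
  proof -
    have False if "f \<in> compositions {}" for f :: "'a \<Rightarrow> 'a" using that by induction auto
    then show ?thesis by blast
  qed
  then obtain \<alpha> where \<alpha>: "\<alpha> \<in> I" using gen U(2) by (force simp: generated_by_def)
  then have u: "g \<alpha> ^^ k \<in> hat G" for k
    using hat_funpow[OF G] gen by (auto simp: generated_by_def hat_def)
  have "\<exists>F. F \<in> hat G \<and> V \<inter> (h \<circ> F \<circ> g \<alpha> ^^ k) ` (h ` U) \<noteq> {}" for k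
  proof -
    \<comment> \<open>The extra factor \<open>h\<close> keeps the map in \<open>G\<close> even when the chain map is the identity.\<close>
    let ?w = "g \<alpha> ^^ k \<circ> h \<circ> h \<circ> p"
    have "?w \<in> G"
      using comp_hat(2)[OF G p(1)] hat_comp[OF G] u hats by blast
    then have chain: "has_chain G \<epsilon> ?w x x" using x(1) \<epsilon>(1) by (auto simp: CR_def)
    have rearr: "e (?w y) = (h \<circ> e \<circ> g \<alpha> ^^ k) (h (p y))" if "e \<in> hat G" for e y
    proof -
      have "e \<circ> g \<alpha> ^^ k \<circ> h = h \<circ> (e \<circ> g \<alpha> ^^ k)"
        using hat_commute[OF ab hat_comp[OF G that u] hats(1)] .
      then show ?thesis by (simp add: fun_eq_iff)
    qed
    obtain y e where ye: "p y \<in> U" "e \<in> hat G" "dist (e (?w y)) x < \<epsilon> (e (?w y))"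
    proof (rule has_chain_last[OF chain, of "\<lambda>y. p y \<in> U"])
      fix y z e assume "p y \<in> U" and e: "e \<in> hat G" and d: "dist (e (?w y)) z < \<epsilon> (e (?w y))"
      then have "e (?w y) \<in> C"
        unfolding rearr[OF e] by (intro C hat_comp[OF G] hats u)
      moreover have "z \<in> ball (e (?w y)) (\<epsilon> (e (?w y)))" using d by simp
      ultimately show "p z \<in> U" using \<epsilon>(3) pU by blast
    qed (use px in blast)+
    \<comment> \<open>The bound \<open>\<epsilon> \<le> \<delta>\<close> puts the last exact value
      within \<open>\<delta>\<close> of x.\<close>
    have "e (?w y) \<in> V" using ye(3) \<epsilon>(2) \<delta>(2) by (force simp: dist_commute intro: less_le_trans)
    then show ?thesis using rearr[OF ye(2)] ye by (metis IntI empty_iff imageI)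
  qed
  then obtain F where F: "\<And>k. F k \<in> hat G" "\<And>k. V \<inter> (h \<circ> F k \<circ> g \<alpha> ^^ k) ` (h ` U) \<noteq> {}"
    by metis
  have "unbounded_seq G I g (\<lambda>k. h \<circ> F k \<circ> g \<alpha> ^^ k)"
    using comp_hat(1)[OF G U(2) F(1)] by (rule unbounded_seq_if_factor[OF G ab gen \<alpha>])
  moreover have "\<exists>\<^sub>\<infinity>k. V \<inter> (h \<circ> F k \<circ> g \<alpha> ^^ k) ` (h ` U) \<noteq> {}"
    using F(2) by (simp add: INFM_nat)
  ultimately show "\<exists>f. unbounded_seq G I g f \<and> (\<exists>\<^sub>\<infinity>k. V \<inter> f k ` (h ` U) \<noteq> {})"
    by blast
qed

theorem theorem3p5:
  fixes G :: "('a::metric_space \<Rightarrow> 'a) set"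
    and I :: "'i set" and g :: "'i \<Rightarrow> 'a \<Rightarrow> 'a"
  assumes "continuous_semigroup G"
    and "abelian G"
    and "generated_by G I g"
  shows "UNIV - CR G =
    (\<Union>(U, h) \<in> {(U, h). trapping_region_with G U h}. basin G U - attractor G I g U h)"
proof (intro equalityI subsetI)
  fix x assume "x \<in> UNIV - CR G"
  then obtain \<epsilon> h where h: "\<epsilon> \<in> pos_continuous" "h \<in> G" "\<not> has_chain G \<epsilon> h x x"
    by (auto simp: CR_def)
  let ?U = "{y. has_chain G \<epsilon> h x y}"
  have trap: "trapping_region_with G ?U h" using trapping_region_has_chain[OF h(1,2)] .
  \<comment> \<open>A single step with the identity and zero error reaches
    \<open>h x\<close>.\<close>
  have "has_chain G \<epsilon> h x (h x)"
    by (rule has_chain_single[of id]) (use h in \<open>auto simp: hat_def pos_continuous_def\<close>)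
  then have "x \<in> basin G ?U" using h(2) by (auto simp: basin_def)
  \<comment> \<open>Membership in the attractor would put x into \<open>?U\<close>, giving the chain
    from x to x that was excluded.\<close>
  moreover have "x \<notin> attractor G I g ?U h" using attractor_subset[OF trap, of I g] h(3) by blast
  ultimately show "x \<in> (\<Union>(U, h) \<in> {(U, h). trapping_region_with G U h}. basin G U - attractor G I g U h)"
    using trap by blast
next
  fix x assume "x \<in> (\<Union>(U, h) \<in> {(U, h). trapping_region_with G U h}. basin G U - attractor G I g U h)"
  then obtain U h where "trapping_region_with G U h" "x \<in> basin G U" "x \<notin> attractor G I g U h"
    by auto
  then show "x \<in> UNIV - CR G" using CR_basin_subset_attractor[OF assms] by auto
qed

end
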